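(* In the two-firm baseline model with exogenous price described in the context, under the regularity assumption, the pooled-Nash and pooled-planner capacities satisfy $$K^*_{\mathrm{NP},1}\leq K^*_{\mathrm{SP},1},\qquad K^*_{\mathrm{NP},2}\leq K^*_{\mathrm{SP},2}.$$ If $\eta'(N)>0$ on the relevant domain, both inequalities are strict.
   Context: Parameters: $r>0$ (per-unit revenue), $c_1>0$, $c_2>0$ (capacity cost coefficients), $\delta\in(0,1]$ (discount factor). The learning curve $\eta:[0,\infty)\to[0,\infty)$ is twice continuously differentiable, strictly increasing, strictly concave and bounded, except in the constant-learning benchmark, where $\eta$ is constant; $\eta_{\min}:=\eta(0)$. Model: two symmetric firms choose capacities $K_{i,1}\ge 0$ and $K_{i,2}\ge K_{i,1}$; firm $i$'s profit is $rK_{i,1}\eta_{\min}-\frac{c_1}{2}K_{i,1}^2+\delta[rK_{i,2}\eta(N)-\frac{c_2}{2}(K_{i,2}-K_{i,1})^2]$, where the period-2 learning state is $N=K_{i,1}$ under fragmentation and $N=K_{1,1}+K_{2,1}$ under pooling. Substituting the optimal period-2 capacity gives the following reduced forms, taken as definitions: $$\phi(K,N):=rK\eta(N)+\frac{r^2}{2c_2}\eta(N)^2,$$ $$V_{\mathrm{NF}}(x):=r\eta_{\min}x-\tfrac{c_1}{2}x^2+\delta\phi(x,x),\qquad V_{\mathrm{SP}}(x):=r\eta_{\min}x-\tfrac{c_1}{2}x^2+\delta\phi(x,2x),$$ $$V_i^{\mathrm{NP}}(x_i,x_j):=r\eta_{\min}x_i-\tfrac{c_1}{2}x_i^2+\delta\phi(x_i,x_i+x_j).$$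 The first-order conditions are $F_{\mathrm{NF}}:=V_{\mathrm{NF}}'$, $F_{\mathrm{SP}}:=V_{\mathrm{SP}}'$, $F_{\mathrm{NP}}(x):=\partial_{x_i}V_i^{\mathrm{NP}}(x_i,x_j)\big|_{x_i=x_j=x}$. Regularity assumption: on the relevant capacity domain, $\eta(N)>0$. The reduced objectives $V_{\mathrm{NF}}$ and $V_{\mathrm{SP}}$ are strictly concave, and $V_i^{\mathrm{NP}}(\cdot,x_j)$ is strictly concave for every relevant $x_j$. The first-order conditions $F_{\mathrm{NF}},F_{\mathrm{NP}},F_{\mathrm{SP}}$ are strictly decreasing and have unique interior roots $x_{\mathrm{NF}},x_{\mathrm{NP}},x_{\mathrm{SP}}\in(0,\infty)$ respectively. (Here "the relevant (capacity) domain" and "relevant $x_j$" refer to the range of capacities and learning states under consideration in the model; the source does not specify this range further.) Capacities: $K^*_{\mathrm{NP},1}:=x_{\mathrm{NP}}$, $K^*_{\mathrm{SP},1}:=x_{\mathrm{SP}}$, $K^*_{\mathrm{NP},2}:=x_{\mathrm{NP}}+\frac{r\eta(2x_{\mathrm{NP}})}{c_2}$, $K^*_{\mathrm{SP},2}:=x_{\mathrm{SP}}+\frac{r\eta(2x_{\mathrm{SP}})}{c_2}$. *)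

theory Defs
  imports "HOL-Analysis.Analysis"
begin

definition strictly_concave_on :: "real set \<Rightarrow> (real \<Rightarrow> real) \<Rightarrow> bool" where
  "strictly_concave_on S f \<longleftrightarrow> convex S \<and>
     (\<forall>x\<in>S. \<forall>y\<in>S. \<forall>t. x \<noteq> y \<and> 0 < t \<and> t < 1 \<longrightarrow>
        (1 - t) * f x + t * f y < f ((1 - t) * x + t * y))"

text \<open>Capacities and learning states are nonnegative reals, but functions of them are total
  functions on the reals whose values at negative arguments carry no meaning. Derivatives are
  therefore taken within the half-line: two-sided at positive points, one-sided at 0.\<close>

definition deriv_nn :: "(real \<Rightarrow> real) \<Rightarrow> real \<Rightarrow> real" where
  "deriv_nn f x = vector_derivative f (at x within {0..})"

definition C2_nn :: "(real \<Rightarrow> real) \<Rightarrow> bool" where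
  "C2_nn f \<longleftrightarrow> f differentiable_on {0..} \<and> deriv_nn f differentiable_on {0..} \<and>
     continuous_on {0..} (deriv_nn (deriv_nn f))"

text \<open>The second disjunct is the constant-learning benchmark.\<close>

definition learning_curve :: "(real \<Rightarrow> real) \<Rightarrow> bool" where
  "learning_curve \<eta> \<longleftrightarrow> (\<forall>N\<ge>0. 0 \<le> \<eta> N) \<and>
     (C2_nn \<eta> \<and> strict_mono_on {0..} \<eta> \<and> strictly_concave_on {0..} \<eta> \<and> bounded (\<eta> ` {0..})
      \<or> \<eta> constant_on {0..})"

definition phi :: "real \<Rightarrow> real \<Rightarrow> (real \<Rightarrow> real) \<Rightarrow> real \<Rightarrow> real \<Rightarrow> real" where
  "phi r c2 \<eta> K N = r * K * \<eta> N + r\<^sup>2 / (2 * c2) * (\<eta> N)\<^sup>2"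

definition V_NF :: "real \<Rightarrow> real \<Rightarrow> real \<Rightarrow> real \<Rightarrow> (real \<Rightarrow> real) \<Rightarrow> real \<Rightarrow> real" where
  "V_NF r c1 c2 \<delta> \<eta> x = r * \<eta> 0 * x - c1 / 2 * x\<^sup>2 + \<delta> * phi r c2 \<eta> x x"

definition V_SP :: "real \<Rightarrow> real \<Rightarrow> real \<Rightarrow> real \<Rightarrow> (real \<Rightarrow> real) \<Rightarrow> real \<Rightarrow> real" where
  "V_SP r c1 c2 \<delta> \<eta> x = r * \<eta> 0 * x - c1 / 2 * x\<^sup>2 + \<delta> * phi r c2 \<eta> x (2 * x)"

definition V_NP :: "real \<Rightarrow> real \<Rightarrow> real \<Rightarrow> real \<Rightarrow> (real \<Rightarrow> real) \<Rightarrow> real \<Rightarrow> real \<Rightarrow> real" where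
  "V_NP r c1 c2 \<delta> \<eta> xi xj =
     r * \<eta> 0 * xi - c1 / 2 * xi\<^sup>2 + \<delta> * phi r c2 \<eta> xi (xi + xj)"

definition F_NF :: "real \<Rightarrow> real \<Rightarrow> real \<Rightarrow> real \<Rightarrow> (real \<Rightarrow> real) \<Rightarrow> real \<Rightarrow> real" where
  "F_NF r c1 c2 \<delta> \<eta> x = deriv_nn (V_NF r c1 c2 \<delta> \<eta>) x"

definition F_SP :: "real \<Rightarrow> real \<Rightarrow> real \<Rightarrow> real \<Rightarrow> (real \<Rightarrow> real) \<Rightarrow> real \<Rightarrow> real" where
  "F_SP r c1 c2 \<delta> \<eta> x = deriv_nn (V_SP r c1 c2 \<delta> \<eta>) x"

definition F_NP :: "real \<Rightarrow> real \<Rightarrow> real \<Rightarrow> real \<Rightarrow> (real \<Rightarrow> real) \<Rightarrow> real \<Rightarrow> real" where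
  "F_NP r c1 c2 \<delta> \<eta> x = deriv_nn (\<lambda>xi. V_NP r c1 c2 \<delta> \<eta> xi x) x"

text \<open>The relevant capacity domain is an arbitrary interval \<open>D\<close> of nonnegative reals; the relevant
  learning states are those reached from it in period 2, under fragmentation or pooling.
  For \<open>D = {0..}\<close> both are the whole half-line and \<open>interior D = {0<..}\<close>.\<close>

definition learning_states :: "real set \<Rightarrow> real set" where
  "learning_states D = D \<union> {x + y |x y. x \<in> D \<and> y \<in> D}"

definition unique_interior_root :: "real set \<Rightarrow> (real \<Rightarrow> real) \<Rightarrow> real \<Rightarrow> bool" where
  "unique_interior_root D F x \<longleftrightarrow>
     x \<in> interior D \<and> F x = 0 \<and> (\<forall>y\<in>interior D. F y = 0 \<longrightarrow> y = x)"

definition regularity ::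
    "real \<Rightarrow> real \<Rightarrow> real \<Rightarrow> real \<Rightarrow> (real \<Rightarrow> real) \<Rightarrow> real set \<Rightarrow> real \<Rightarrow> real \<Rightarrow> real \<Rightarrow> bool" where
  "regularity r c1 c2 \<delta> \<eta> D x_NF x_NP x_SP \<longleftrightarrow>
     is_interval D \<and> D \<subseteq> {0..} \<and>
     (\<forall>N\<in>learning_states D. 0 < \<eta> N) \<and>
     strictly_concave_on D (V_NF r c1 c2 \<delta> \<eta>) \<and>
     strictly_concave_on D (V_SP r c1 c2 \<delta> \<eta>) \<and>
     (\<forall>xj\<in>D. strictly_concave_on D (\<lambda>xi. V_NP r c1 c2 \<delta> \<eta> xi xj)) \<and>
     strict_antimono_on D (F_NF r c1 c2 \<delta> \<eta>) \<and>
     strict_antimono_on D (F_NP r c1 c2 \<delta> \<eta>) \<and>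
     strict_antimono_on D (F_SP r c1 c2 \<delta> \<eta>) \<and>
     unique_interior_root D (F_NF r c1 c2 \<delta> \<eta>) x_NF \<and>
     unique_interior_root D (F_NP r c1 c2 \<delta> \<eta>) x_NP \<and>
     unique_interior_root D (F_SP r c1 c2 \<delta> \<eta>) x_SP"

text \<open>Optimal period-2 capacity of a firm under pooling when both firms choose \<open>x\<close> in period 1,
  so that the learning state is \<open>2 * x\<close>.\<close>

definition pooled_K2 :: "real \<Rightarrow> real \<Rightarrow> (real \<Rightarrow> real) \<Rightarrow> real \<Rightarrow> real" where
  "pooled_K2 r c2 \<eta> x = x + r * \<eta> (2 * x) / c2"

end

theory Submission
  imports Defs
begin

text \<open>A Nash firm ignores the benefit of its capacity for the rival's learning. Hence the two
  first-order conditions at a symmetric capacity \<open>x > 0\<close> differ only by the externality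
  \<open>F_SP x - F_NP x = \<delta> * \<eta>'(2 x) * (r * x + r\<^sup>2 / c2 * \<eta>(2 x)) \<ge> 0\<close>. At the Nash root this gives
  \<open>F_SP x_NP \<ge> 0 = F_SP x_SP\<close>, so \<open>x_NP \<le> x_SP\<close> because \<open>F_SP\<close> is strictly decreasing; the
  period-2 capacity is an increasing function of the period-1 capacity.\<close>

text \<open>Positive points are interior to the half-line, so there the one-sided notion agrees with
  the usual derivative and the calculus rules at a full neighbourhood apply.\<close>

lemma deriv_nn_eq:
  assumes "0 < x" and "(f has_real_derivative d) (at x)"
  shows "deriv_nn f x = d"
proof -
  have "at x within {0..} = at x"
    using assms(1) by (intro at_within_interior) (simp add: interior_real_atLeast)
  then show ?thesis
    using assms(2) unfolding deriv_nn_def has_real_derivative_iff_has_vector_derivative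
    by (simp add: vector_derivative_at)
qed

text \<open>Weak monotonicity is what the strictly increasing curve and the constant benchmark have
  in common.\<close>

lemma learning_curve_mono:
  assumes "learning_curve \<eta>"
  shows "mono_on {0..} \<eta>"
  using assms unfolding learning_curve_def
  by (auto simp: constant_on_def intro!: mono_onI dest: strict_mono_on_leD)

lemma learning_curve_has_derivative:
  assumes "learning_curve \<eta>" and "0 < N"
  shows "(\<eta> has_real_derivative deriv_nn \<eta> N) (at N)"
proof -
  \<comment> \<open>In the benchmark \<open>\<eta>\<close> is constant only on the half-line, so
    differentiability within \<open>{0..}\<close> is transferred from a genuinely constant
    function.\<close>
  have "\<eta> differentiable_on {0..}" if "\<eta> constant_on {0..}"
  proof -
    from that obtain c where "\<And>x. x \<in> {0..} \<Longrightarrow> \<eta> x = c"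
      by (auto simp: constant_on_def)
    then show ?thesis
      unfolding differentiable_on_def
      by (metis differentiable_const differentiable_transform_within zero_less_one)
  qed
  then have "\<eta> differentiable_on {0..}"
    using assms(1) unfolding learning_curve_def C2_nn_def by blast
  then have "\<eta> differentiable (at N)"
    using assms(2) at_within_interior[of N "{0..}"]
    by (metis atLeast_iff differentiable_on_def greaterThan_iff interior_real_atLeast less_imp_le)
  then obtain d where "(\<eta> has_real_derivative d) (at N)"
    by (auto simp: real_differentiable_def)
  then show ?thesis
    using deriv_nn_eq[OF assms(2)] by simp
qed

lemma learning_curve_deriv_nonneg:
  assumes "learning_curve \<eta>" and "0 < N"
  shows "0 \<le> deriv_nn \<eta> N"
  using mono_on_imp_deriv_nonneg[OF learning_curve_mono learning_curve_has_derivative] assms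
  by (simp add: interior_real_atLeast)

text \<open>Capacity and learning state are kept as separate functions so that one computation
  serves both regimes; these differ in \<open>N'\<close>, the rate at which own capacity moves the
  state.\<close>

lemma phi_has_derivative:
  assumes "(K has_real_derivative K') (at x)" and "(N has_real_derivative N') (at x)"
    and "(\<eta> has_real_derivative d) (at (N x))"
  shows "((\<lambda>x. phi r c2 \<eta> (K x) (N x)) has_real_derivative
    r * K' * \<eta> (N x) + (r * K x + r\<^sup>2 / c2 * \<eta> (N x)) * d * N') (at x)"
proof -
  have "((\<lambda>x. \<eta> (N x)) has_real_derivative d * N') (at x)"
    using DERIV_chain2[OF assms(3,2)] .
  \<comment> \<open>The free \<open>a\<close> stands for \<open>r\<^sup>2 / c2\<close>, which keeps
    the division by \<open>c2\<close> out of the algebra.\<close>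
  then have "((\<lambda>x. r * K x * \<eta> (N x) + a / 2 * (\<eta> (N x))\<^sup>2) has_real_derivative
      r * K' * \<eta> (N x) + (r * K x + a * \<eta> (N x)) * d * N') (at x)" for a
    by (auto intro!: derivative_eq_intros assms(1) simp: algebra_simps)
  from this[of "r\<^sup>2 / c2"] show ?thesis
    by (simp add: phi_def mult.commute)
qed

text \<open>The planner moves both firms together: the state \<open>2 * x\<close> has slope 2, hence
  the doubled learning term.\<close>

lemma F_SP_eq:
  assumes "learning_curve \<eta>" and "0 < x"
  shows "F_SP r c1 c2 \<delta> \<eta> x = r * \<eta> 0 - c1 * x + \<delta> * (r * \<eta> (2 * x)
    + 2 * (r * x + r\<^sup>2 / c2 * \<eta> (2 * x)) * deriv_nn \<eta> (2 * x))"
proof -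
  have "((\<lambda>x. phi r c2 \<eta> x (2 * x)) has_real_derivative
      r * 1 * \<eta> (2 * x) + (r * x + r\<^sup>2 / c2 * \<eta> (2 * x)) * deriv_nn \<eta> (2 * x) * 2) (at x)"
    using assms
    by (intro phi_has_derivative learning_curve_has_derivative) (auto intro!: derivative_eq_intros)
  then show ?thesis
    unfolding F_SP_def V_SP_def using assms(2)
    by (intro deriv_nn_eq) (auto intro!: derivative_eq_intros)
qed

text \<open>The rival's capacity is frozen while differentiating, so the state has slope 1; symmetry
  is imposed only afterwards.\<close>

lemma F_NP_eq:
  assumes "learning_curve \<eta>" and "0 < x"
  shows "F_NP r c1 c2 \<delta> \<eta> x = r * \<eta> 0 - c1 * x + \<delta> * (r * \<eta> (2 * x)
    + (r * x + r\<^sup>2 / c2 * \<eta> (2 * x)) * deriv_nn \<eta> (2 * x))"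
proof -
  have "((\<lambda>y. phi r c2 \<eta> y (y + x)) has_real_derivative
      r * 1 * \<eta> (x + x) + (r * x + r\<^sup>2 / c2 * \<eta> (x + x)) * deriv_nn \<eta> (x + x) * 1) (at x)"
    using assms
    by (intro phi_has_derivative learning_curve_has_derivative) (auto intro!: derivative_eq_intros)
  then show ?thesis
    unfolding F_NP_def V_NP_def mult_2 using assms(2)
    by (intro deriv_nn_eq) (auto intro!: derivative_eq_intros)
qed

lemma F_SP_minus_F_NP:
  assumes "learning_curve \<eta>" and "0 < x"
  shows "F_SP r c1 c2 \<delta> \<eta> x - F_NP r c1 c2 \<delta> \<eta> x =
    \<delta> * (r * x + r\<^sup>2 / c2 * \<eta> (2 * x)) * deriv_nn \<eta> (2 * x)"
  unfolding F_SP_eq[OF assms] F_NP_eq[OF assms] by (simp add: algebra_simps)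

text \<open>Strictness comes from the summand \<open>x\<close>; the learning summand need only be
  nondecreasing.\<close>

lemma pooled_K2_strict_mono:
  assumes "mono_on {0..} \<eta>" and "0 < r" and "0 < c2"
  shows "strict_mono_on {0..} (pooled_K2 r c2 \<eta>)"
proof (rule strict_mono_onI)
  fix x y :: real
  assume "x \<in> {0..}" "y \<in> {0..}" "x < y"
  then have "r * \<eta> (2 * x) / c2 \<le> r * \<eta> (2 * y) / c2"
    using assms by (intro divide_right_mono mult_left_mono mono_onD[OF assms(1)]) auto
  with \<open>x < y\<close> show "pooled_K2 r c2 \<eta> x < pooled_K2 r c2 \<eta> y"
    by (simp add: pooled_K2_def)
qed

theorem proposition2:
  fixes r c1 c2 \<delta> :: real and \<eta> :: "real \<Rightarrow> real" and D :: "real set"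
    and x_NF x_NP x_SP :: real
  assumes "0 < r" and "0 < c1" and "0 < c2" and "0 < \<delta>" and "\<delta> \<le> 1"
    and "learning_curve \<eta>"
    and "regularity r c1 c2 \<delta> \<eta> D x_NF x_NP x_SP"
  shows "x_NP \<le> x_SP \<and> pooled_K2 r c2 \<eta> x_NP \<le> pooled_K2 r c2 \<eta> x_SP \<and>
    ((\<forall>N\<in>learning_states D. 0 < deriv_nn \<eta> N) \<longrightarrow>
       x_NP < x_SP \<and> pooled_K2 r c2 \<eta> x_NP < pooled_K2 r c2 \<eta> x_SP)"
proof -
  let ?SP = "F_SP r c1 c2 \<delta> \<eta>" and ?NP = "F_NP r c1 c2 \<delta> \<eta>"
  have D: "D \<subseteq> {0..}" and anti: "strict_antimono_on D ?SP"
    and int: "x_NP \<in> interior D" "x_SP \<in> interior D"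
    and roots: "?NP x_NP = 0" "?SP x_SP = 0"
    using assms(7) unfolding regularity_def unique_interior_root_def by auto
  have inD: "x_NP \<in> D" "x_SP \<in> D"
    using int interior_subset by auto
  \<comment> \<open>An interior point of \<open>D\<close> is interior to the half-line, hence
    positive.\<close>
  have pos: "0 < x_NP" "0 < x_SP"
    using int interior_mono[OF D] by (auto simp: interior_real_atLeast)
  have "0 \<le> \<eta> (2 * x_NP)"
    using assms(6) pos by (simp add: learning_curve_def)
  \<comment> \<open>Strict positivity comes from \<open>r * x_NP\<close>; the learning term adds a
    nonnegative amount.\<close>
  then have weight: "0 < \<delta> * (r * x_NP + r\<^sup>2 / c2 * \<eta> (2 * x_NP))"
    using assms(1,3,4) pos by (intro mult_pos_pos add_pos_nonneg) auto
  have SP: "?SP x_NP = \<delta> * (r * x_NP + r\<^sup>2 / c2 * \<eta> (2 * x_NP)) * deriv_nn \<eta> (2 * x_NP)"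
    using F_SP_minus_F_NP[OF assms(6) pos(1), of r c1 c2 \<delta>] roots by simp
  have "0 \<le> ?SP x_NP"
    unfolding SP using weight learning_curve_deriv_nonneg[OF assms(6)] pos by simp
  \<comment> \<open>If \<open>x_SP < x_NP\<close>, strict decrease would make
    \<open>?SP x_NP\<close> negative.\<close>
  then have le: "x_NP \<le> x_SP"
    using monotone_onD[OF anti inD(2,1)] roots by fastforce
  have less: "x_NP < x_SP" if "\<forall>N\<in>learning_states D. 0 < deriv_nn \<eta> N"
  proof -
    \<comment> \<open>The pooled state at the Nash root is a sum of two capacities in
      \<open>D\<close>, so the assumption on the slope applies there.\<close>
    have "2 * x_NP \<in> learning_states D"
      using inD unfolding learning_states_def mult_2 by blast
    then have "0 < ?SP x_NP"
      unfolding SP using weight that by simp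
    \<comment> \<open>Equality is excluded because \<open>?SP\<close> vanishes at
      \<open>x_SP\<close> but is positive at \<open>x_NP\<close>.\<close>
    then show ?thesis
      using le roots by (cases "x_NP = x_SP") auto
  qed
  have K2: "strict_mono_on {0..} (pooled_K2 r c2 \<eta>)"
    using pooled_K2_strict_mono[OF learning_curve_mono[OF assms(6)] assms(1,3)] .
  show ?thesis
    using le less strict_mono_onD[OF K2, of x_NP x_SP] strict_mono_on_leD[OF K2, of x_NP x_SP] pos
    by auto
qed

end
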